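(* Let $R$ be a commutative ring, let $U=(u_{ij})$ be a $k\times k$ matrix over $R$ and let $A_1,A_2,\ldots,A_k$ be $n\times n$ matrices over $R$. Let $T=(U;A_1,A_2,\ldots,A_k)$ be the left matrix tangle product of $\{A_1,\ldots,A_k\}$ relative to $U$. Then $$\det T=\det(A_1)\det(A_2)\cdots\det(A_k)\,(\det U)^n.$$
   Context: The left matrix tangle product $(U;A_1,\ldots,A_k)$ of $n\times n$ matrices $A_1,\ldots,A_k$ relative to a $k\times k$ matrix $U=(u_{ij})$ is the $nk\times nk$ block matrix whose $(i,j)$ block is $A_ju_{ij}$, i.e. $$\begin{pmatrix} A_1u_{11} & A_2u_{12} & \cdots & A_ku_{1k}\\ A_1u_{21} & A_2u_{22} & \cdots & A_ku_{2k}\\ \vdots & \vdots & & \vdots\\ A_1u_{k1} & A_2u_{k2} & \cdots & A_ku_{kk}\end{pmatrix}.$$ *)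

theory Defs
  imports "Jordan_Normal_Form.Determinant"
begin

definition block_mat :: "nat \<Rightarrow> nat \<Rightarrow> (nat \<Rightarrow> nat \<Rightarrow> 'a mat) \<Rightarrow> 'a mat" where
  "block_mat k n B = mat (k * n) (k * n) (\<lambda>(r, c). B (r div n) (c div n) $$ (r mod n, c mod n))"

text \<open>
  Blocks and list entries are numbered from 0, so \<open>As ! j\<close> is the matrix usually written
  with index \<open>j + 1\<close>. The ring is commutative, so the block \<open>A\<^sub>j u\<^sub>i\<^sub>j\<close> is a
  scalar multiple, written with the library's left scalar multiplication.
  The block size \<open>n\<close> is explicit because it cannot be recovered from an empty list \<open>As\<close>.
\<close>

definition left_tangle_product :: "nat \<Rightarrow> 'a :: comm_ring_1 mat \<Rightarrow> 'a mat list \<Rightarrow> 'a mat" where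
  "left_tangle_product n U As =
     block_mat (length As) n (\<lambda>i j. U $$ (i, j) \<cdot>\<^sub>m (As ! j))"

lemma left_tangle_product_carrier:
  "left_tangle_product n U As \<in> carrier_mat (length As * n) (length As * n)"
  by (simp add: left_tangle_product_def block_mat_def)

lemma left_tangle_product_index:
  assumes "set As \<subseteq> carrier_mat n n" and "i < length As" and "j < length As"
    and "r < n" and "c < n"
  shows "left_tangle_product n U As $$ (i * n + r, j * n + c) = (As ! j) $$ (r, c) * U $$ (i, j)"
proof -
  have *: "i * n + r < length As * n" if "i < length As" "r < n" for i r
  proof -
    have "i * n + r < Suc i * n" using that by simp
    also have "\<dots> \<le> length As * n" using that by (intro mult_right_mono) auto
    finally show ?thesis .
  qed
  have "As ! j \<in> carrier_mat n n" using assms by auto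
  then show ?thesis
    using assms *[OF assms(2,4)] *[OF assms(3,5)]
    by (simp add: left_tangle_product_def block_mat_def mult.commute)
qed

end

theory Submission imports Defs begin

text \<open>
  Column block \<open>j\<close> of the tangle product is column block \<open>j\<close> of the Kronecker product
  \<open>U \<otimes> I\<close> multiplied on the right by \<open>A\<^sub>j\<close>, because \<open>u\<^sub>i\<^sub>j A\<^sub>j = (u\<^sub>i\<^sub>j I) A\<^sub>j\<close>. Hence
  \<open>T = (U \<otimes> I) \<cdot> diag(A\<^sub>1, \<dots>, A\<^sub>k)\<close> (\<open>left_tangle_product_factorization\<close>), and the
  two factors are treated separately.

  The determinant of a block diagonal matrix is the product of the determinants of its blocks
  (\<open>det_diag_block_mat\<close>). The ring may have zero divisors, so elimination over the
  fraction field cannot be used; instead \<open>diag(A, B) = diag(A, I) \<cdot> diag(I, B)\<close>, and the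
  identity blocks are stripped off one row and column at a time.

  The matrix \<open>U \<otimes> I\<close> also reduces to this case: numbering the pair \<open>(i, r)\<close> of a block and
  a position in it by the position first turns \<open>U \<otimes> I\<^sub>n\<close> into
  \<open>I\<^sub>n \<otimes> U = diag(U, \<dots>, U)\<close>. This renumbering acts on rows and columns at once, so its sign
  appears twice and cancels, which leaves \<open>(det U)\<^sup>n\<close> (\<open>det_kronecker_one\<close>).
\<close>

section \<open>Determinants of block diagonal matrices over a commutative ring\<close>

lemma four_block_diag_one_right_Suc:
  fixes A :: "'a :: comm_ring_1 mat"
  assumes "A \<in> carrier_mat n n"
  shows "four_block_mat A (0\<^sub>m n (Suc m)) (0\<^sub>m (Suc m) n) (1\<^sub>m (Suc m)) =
    four_block_mat (four_block_mat A (0\<^sub>m n m) (0\<^sub>m m n) (1\<^sub>m m))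
      (0\<^sub>m (n + m) 1) (0\<^sub>m 1 (n + m)) (1\<^sub>m 1)"
  using assms by (intro eq_matI) auto

lemma det_four_block_diag_one_right:
  fixes A :: "'a :: comm_ring_1 mat"
  assumes A: "A \<in> carrier_mat n n"
  shows "det (four_block_mat A (0\<^sub>m n m) (0\<^sub>m m n) (1\<^sub>m m)) = det A"
proof (induction m)
  case 0
  have "four_block_mat A (0\<^sub>m n 0) (0\<^sub>m 0 n) (1\<^sub>m 0) = A"
    using A by (intro eq_matI) auto
  then show ?case by simp
next
  case (Suc m)
  have "four_block_mat A (0\<^sub>m n m) (0\<^sub>m m n) (1\<^sub>m m) \<in> carrier_mat (n + m) (n + m)"
    using A by simp
  then show ?case
    unfolding four_block_diag_one_right_Suc[OF A]
    by (subst det_four_block_mat_upper_right_zero_col[where n = "n + m"]) (simp_all add: Suc.IH)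
qed

lemma four_block_diag_one_left_Suc:
  fixes B :: "'a :: comm_ring_1 mat"
  assumes "B \<in> carrier_mat n n"
  shows "four_block_mat (1\<^sub>m (Suc m)) (0\<^sub>m (Suc m) n) (0\<^sub>m n (Suc m)) B =
    four_block_mat (1\<^sub>m 1) (0\<^sub>m 1 (m + n)) (0\<^sub>m (m + n) 1)
      (four_block_mat (1\<^sub>m m) (0\<^sub>m m n) (0\<^sub>m n m) B)"
  using assms by (intro eq_matI) auto

lemma det_four_block_diag_one_left:
  fixes B :: "'a :: comm_ring_1 mat"
  assumes B: "B \<in> carrier_mat n n"
  shows "det (four_block_mat (1\<^sub>m m) (0\<^sub>m m n) (0\<^sub>m n m) B) = det B"
proof (induction m)
  case 0
  have "four_block_mat (1\<^sub>m 0) (0\<^sub>m 0 n) (0\<^sub>m n 0) B = B"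
    using B by (intro eq_matI) auto
  then show ?case by simp
next
  case (Suc m)
  have "four_block_mat (1\<^sub>m m) (0\<^sub>m m n) (0\<^sub>m n m) B \<in> carrier_mat (m + n) (m + n)"
    using B by simp
  then show ?case
    unfolding four_block_diag_one_left_Suc[OF B]
    by (subst det_four_block_mat_lower_left_zero_col[where n = "m + n"]) (simp_all add: Suc.IH)
qed

text \<open>
  Since \<open>diag(A, B) = diag(A, I) \<cdot> diag(I, B)\<close>, multiplicativity of the determinant leaves only
  factors with an identity block, and no ring element has to be inverted.
\<close>

lemma det_four_block_diag:
  fixes A :: "'a :: comm_ring_1 mat"
  assumes A: "A \<in> carrier_mat n n" and B: "B \<in> carrier_mat m m"
  shows "det (four_block_mat A (0\<^sub>m n m) (0\<^sub>m m n) B) = det A * det B"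
proof -
  let ?L = "four_block_mat A (0\<^sub>m n m) (0\<^sub>m m n) (1\<^sub>m m)"
  let ?R = "four_block_mat (1\<^sub>m n) (0\<^sub>m n m) (0\<^sub>m m n) B"
  have "four_block_mat A (0\<^sub>m n m) (0\<^sub>m m n) B = ?L * ?R"
    using A B by (subst mult_four_block_mat[of _ n n _ m _ m _ _ n _ m]) auto
  moreover have "?L \<in> carrier_mat (n + m) (n + m)" "?R \<in> carrier_mat (n + m) (n + m)"
    using A B by simp_all
  ultimately show ?thesis
    using A B by (simp add: det_mult[of _ "n + m"] det_four_block_diag_one_right
        det_four_block_diag_one_left)
qed

lemma det_diag_block_mat:
  fixes As :: "'a :: comm_ring_1 mat list"
  assumes "\<forall>A \<in> set As. square_mat A"
  shows "det (diag_block_mat As) = (\<Prod>A\<leftarrow>As. det A)"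
  using assms
proof (induction As)
  case Nil
  then show ?case by simp
next
  case (Cons A As)
  let ?D = "diag_block_mat As"
  have "square_mat ?D"
    using Cons.prems by (intro diag_block_mat_square) auto
  then have D: "?D \<in> carrier_mat (dim_row ?D) (dim_row ?D)" and D': "dim_col ?D = dim_row ?D"
    by (simp_all only: carrier_mat_def square_mat.simps mem_Collect_eq)
  have A: "A \<in> carrier_mat (dim_row A) (dim_row A)" and A': "dim_col A = dim_row A"
    using Cons.prems by (simp_all only: carrier_mat_def square_mat.simps mem_Collect_eq list.set_intros)
  have "det (diag_block_mat (A # As)) = det A * det ?D"
    unfolding diag_block_mat.simps Let_def D' A' by (rule det_four_block_diag[OF A D])
  then show ?case
    using Cons by simp
qed

text \<open>
  The recursive block diagonal matrix suits induction on the list of blocks; its entries are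
  easier to compare with those of the tangle product in the indexed form below.
\<close>

lemma diag_block_mat_eq_block_mat:
  fixes As :: "'a :: zero mat list"
  assumes "set As \<subseteq> carrier_mat n n"
  shows "diag_block_mat As =
    block_mat (length As) n (\<lambda>i j. if i = j then As ! i else 0\<^sub>m n n)"
  using assms
proof (induction As)
  case Nil
  then show ?case by (auto simp: block_mat_def)
next
  case (Cons A As)
  let ?B = "block_mat (length As) n (\<lambda>i j. if i = j then As ! i else 0\<^sub>m n n)"
  have A: "A \<in> carrier_mat n n" using Cons.prems by simp
  have IH: "diag_block_mat As = ?B" using Cons by simp
  have dim: "dim_row ?B = length As * n" "dim_col ?B = length As * n"
    by (simp_all add: block_mat_def)
  have div_mod: "x div n = Suc ((x - n) div n)" "x mod n = (x - n) mod n"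
    if "n \<le> x" "0 < n" for x
    using that by (simp_all add: le_div_geq le_mod_geq)
  show ?case
  proof (rule eq_matI)
    fix a b
    assume "a < dim_row (block_mat (length (A # As)) n
        (\<lambda>i j. if i = j then (A # As) ! i else 0\<^sub>m n n))"
      and "b < dim_col (block_mat (length (A # As)) n
        (\<lambda>i j. if i = j then (A # As) ! i else 0\<^sub>m n n))"
    then have ab: "a < n + length As * n" "b < n + length As * n"
      by (simp_all add: block_mat_def)
    then have n: "0 < n" by (cases n) auto
    show "diag_block_mat (A # As) $$ (a, b) = block_mat (length (A # As)) n
        (\<lambda>i j. if i = j then (A # As) ! i else 0\<^sub>m n n) $$ (a, b)"
      using A ab n
      by (cases "a < n"; cases "b < n")
        (auto simp: IH Let_def dim block_mat_def div_mod not_less)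
  qed (use A in \<open>simp_all add: IH Let_def dim, simp_all add: block_mat_def\<close>)
qed

section \<open>The Kronecker product of a matrix with an identity matrix\<close>

text \<open>
  Permuting the rows and permuting the columns contribute the same sign, and its square is 1.
\<close>

lemma det_permute_rows_cols:
  fixes A :: "'a :: comm_ring_1 mat"
  assumes A: "A \<in> carrier_mat n n" and p: "p permutes {0..<n}"
  shows "det (mat n n (\<lambda>(i, j). A $$ (p i, p j))) = det A"
proof -
  let ?C = "mat n n (\<lambda>(i, j). A\<^sup>T $$ (p i, j))"
  have p_less: "p i < n" if "i < n" for i
    using permutes_in_image[OF p, of i] that by simp
  have "mat n n (\<lambda>(i, j). A $$ (p i, p j)) = mat n n (\<lambda>(i, j). ?C\<^sup>T $$ (p i, j))"
    using A p_less by (intro eq_matI) auto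
  then have "det (mat n n (\<lambda>(i, j). A $$ (p i, p j))) = signof p * det (?C\<^sup>T)"
    using p by (simp add: det_permute_rows)
  also have "det (?C\<^sup>T) = det ?C"
    by (rule det_transpose[of _ n]) simp
  also have "det ?C = signof p * det (A\<^sup>T)"
    using A p by (intro det_permute_rows) simp_all
  also have "det (A\<^sup>T) = det A"
    using A by (rule det_transpose)
  finally show ?thesis
    by (simp add: sign_def)
qed

definition kronecker_one :: "nat \<Rightarrow> nat \<Rightarrow> 'a :: comm_ring_1 mat \<Rightarrow> 'a mat" where
  "kronecker_one k n U = block_mat k n (\<lambda>i j. U $$ (i, j) \<cdot>\<^sub>m 1\<^sub>m n)"

lemma mult_add_less_mult:
  fixes q r k n :: nat
  assumes "q < k" "r < n"
  shows "q * n + r < k * n"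
proof -
  have "q * n + r < Suc q * n" using assms(2) by simp
  also have "\<dots> \<le> k * n" using assms(1) by (intro mult_right_mono) auto
  finally show ?thesis .
qed

text \<open>
  Transposition of a \<open>k \<times> n\<close> array stored row by row: it exchanges quotient and remainder. The
  identity outside the array makes it a permutation of all natural numbers.
\<close>

definition perfect_shuffle :: "nat \<Rightarrow> nat \<Rightarrow> nat \<Rightarrow> nat" where
  "perfect_shuffle k n a = (if a < k * n then (a mod n) * k + a div n else a)"

lemma div_mod_less:
  fixes a k n :: nat
  assumes "a < k * n"
  shows "a div n < k" "a mod n < n"
  using assms by (auto simp: less_mult_imp_div_less intro!: mod_less_divisor gr0I)

lemma perfect_shuffle_div_mod:
  assumes "a < k * n"
  shows "perfect_shuffle k n a < n * k"
    and "perfect_shuffle k n a div k = a mod n"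
    and "perfect_shuffle k n a mod k = a div n"
  using assms div_mod_less[OF assms] mult_add_less_mult[of "a mod n" n "a div n" k]
  by (auto simp: perfect_shuffle_def)

lemma perfect_shuffle_permutes: "perfect_shuffle k n permutes {0..<k * n}"
proof (rule bij_imp_permutes)
  show "bij_betw (perfect_shuffle k n) {0..<k * n} {0..<k * n}"
  proof (rule bij_betw_byWitness[where f' = "perfect_shuffle n k"])
    have inverse: "perfect_shuffle n k (perfect_shuffle k n a) = a"
      if "a < k * n" for a k n
      using perfect_shuffle_div_mod[OF that] by (simp add: perfect_shuffle_def[of n k])
    show "\<forall>a \<in> {0..<k * n}. perfect_shuffle n k (perfect_shuffle k n a) = a"
      and "\<forall>a \<in> {0..<k * n}. perfect_shuffle k n (perfect_shuffle n k a) = a"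
      using inverse by (auto simp: mult.commute)
    show "perfect_shuffle k n ` {0..<k * n} \<subseteq> {0..<k * n}"
      and "perfect_shuffle n k ` {0..<k * n} \<subseteq> {0..<k * n}"
      using perfect_shuffle_div_mod(1)[of _ k n] perfect_shuffle_div_mod(1)[of _ n k]
      by (auto simp: mult.commute)
  qed
qed (simp add: perfect_shuffle_def)

text \<open>
  An entry of \<open>U \<otimes> I\<^sub>n\<close> vanishes unless the remainders modulo \<open>n\<close> of its two indices agree, and
  otherwise is the entry of \<open>U\<close> at the two quotients. After the shuffle the remainders number
  the blocks and the quotients are positions in a block, so this describes \<open>diag(U, \<dots>, U)\<close>.
\<close>

lemma kronecker_one_eq_shuffled_diag:
  fixes U :: "'a :: comm_ring_1 mat"
  assumes U: "U \<in> carrier_mat k k"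
  shows "kronecker_one k n U = mat (k * n) (k * n)
    (\<lambda>(a, b). diag_block_mat (replicate n U) $$ (perfect_shuffle k n a, perfect_shuffle k n b))"
proof -
  have diag: "diag_block_mat (replicate n U) =
      block_mat n k (\<lambda>i j. if i = j then replicate n U ! i else 0\<^sub>m k k)"
    using U diag_block_mat_eq_block_mat[of "replicate n U" k]
    by (simp add: set_replicate_conv_if)
  show ?thesis
  proof (rule eq_matI, goal_cases)
    case (1 a b)
    then have a: "a < k * n" and b: "b < k * n" by simp_all
    then show ?case
      using U perfect_shuffle_div_mod[OF a] perfect_shuffle_div_mod[OF b]
        div_mod_less[OF a] div_mod_less[OF b]
      by (simp add: kronecker_one_def diag block_mat_def)
  qed (simp_all add: kronecker_one_def block_mat_def)
qed

lemma det_kronecker_one: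
  fixes U :: "'a :: comm_ring_1 mat"
  assumes U: "U \<in> carrier_mat k k"
  shows "det (kronecker_one k n U) = det U ^ n"
proof -
  have "diag_block_mat (replicate n U) \<in> carrier_mat (k * n) (k * n)"
    using U by (intro carrier_matI)
      (simp_all add: dim_diag_block_mat map_replicate_const sum_list_replicate mult.commute)
  then have "det (kronecker_one k n U) = det (diag_block_mat (replicate n U))"
    unfolding kronecker_one_eq_shuffled_diag[OF U]
    by (rule det_permute_rows_cols[OF _ perfect_shuffle_permutes])
  also have "\<dots> = det U ^ n"
    using U by (subst det_diag_block_mat) auto
  finally show ?thesis .
qed

section \<open>Factorization of the tangle product\<close>

lemma left_tangle_product_factorization:
  fixes U :: "'a :: comm_ring_1 mat"
  assumes As: "set As \<subseteq> carrier_mat n n"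
  shows "left_tangle_product n U As = kronecker_one (length As) n U * diag_block_mat As"
proof -
  let ?k = "length As"
  let ?K = "kronecker_one ?k n U"
  let ?D = "block_mat ?k n (\<lambda>i j. if i = j then As ! i else 0\<^sub>m n n)"
  have dim: "dim_row ?K = ?k * n" "dim_col ?K = ?k * n" "dim_row ?D = ?k * n" "dim_col ?D = ?k * n"
    by (simp_all add: kronecker_one_def block_mat_def)
  have "left_tangle_product n U As = ?K * ?D"
  proof (rule eq_matI, goal_cases)
    case (1 a b)
    then have a: "a < ?k * n" and b: "b < ?k * n" by (simp_all add: dim)
    note ab = div_mod_less[OF a] div_mod_less[OF b]
    have Ab: "As ! (b div n) \<in> carrier_mat n n" using As ab by auto
    let ?t = "U $$ (a div n, b div n) * (As ! (b div n)) $$ (a mod n, b mod n)"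
    \<comment> \<open>Row \<open>a\<close> of the first factor meets column \<open>b\<close> of the second only in the index that
      combines the block of \<open>b\<close> with the position of \<open>a\<close>.\<close>
    let ?c = "b div n * n + a mod n"
    have c: "?c < ?k * n" using ab by (intro mult_add_less_mult)
    have "(?K * ?D) $$ (a, b) = (\<Sum>c = 0..<?k * n. ?K $$ (a, c) * ?D $$ (c, b))"
      using a b dim by (simp add: scalar_prod_def)
    also have "\<dots> = (\<Sum>c = 0..<?k * n. if c = ?c then ?t else 0)"
    proof (rule sum.cong[OF refl])
      fix c assume "c \<in> {0..<?k * n}"
      then have c: "c < ?k * n" by simp
      have "c = ?c \<longleftrightarrow> c div n = b div n \<and> c mod n = a mod n"
      proof
        assume "c = ?c"
        then show "c div n = b div n \<and> c mod n = a mod n" using ab by simp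
      next
        assume "c div n = b div n \<and> c mod n = a mod n"
        then show "c = ?c" using div_mult_mod_eq[of c n] by simp
      qed
      then show "?K $$ (a, c) * ?D $$ (c, b) = (if c = ?c then ?t else 0)"
        using a b c ab div_mod_less[OF c] Ab
        by (auto simp: kronecker_one_def block_mat_def)
    qed
    also have "\<dots> = ?t" using c by simp
    also have "\<dots> = left_tangle_product n U As $$ (a, b)"
      using a b ab Ab by (simp add: left_tangle_product_def block_mat_def)
    finally show ?case ..
  qed (simp_all add: dim left_tangle_product_def, simp_all add: block_mat_def)
  then show ?thesis by (simp add: diag_block_mat_eq_block_mat[OF As])
qed

theorem proposition2p4:
  fixes U :: "'a :: comm_ring_1 mat" and As :: "'a mat list" and n k :: nat
  assumes "U \<in> carrier_mat k k"
    and "length As = k"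
    and "set As \<subseteq> carrier_mat n n"
  shows "det (left_tangle_product n U As) = (\<Prod>A\<leftarrow>As. det A) * det U ^ n"
proof -
  have "kronecker_one k n U \<in> carrier_mat (k * n) (k * n)"
    by (simp add: kronecker_one_def block_mat_def)
  moreover have "diag_block_mat As \<in> carrier_mat (k * n) (k * n)"
    using assms(2) by (simp add: diag_block_mat_eq_block_mat[OF assms(3)] block_mat_def)
  ultimately have "det (left_tangle_product n U As) =
      det (kronecker_one k n U) * det (diag_block_mat As)"
    using left_tangle_product_factorization[OF assms(3), of U] assms(2) by (simp add: det_mult)
  also have "det (diag_block_mat As) = (\<Prod>A\<leftarrow>As. det A)"
    using assms(3) by (intro det_diag_block_mat) auto
  finally show ?thesis
    using assms(1) by (simp add: det_kronecker_one mult.commute)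
qed

end
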